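(* Consider the model $Y=X\beta^*+\sigma\xi$ with $\xi_1,\dots,\xi_n$ i.i.d. $N(0,1)$, and integers $s,s_0,m,d$ with $25\le s<m/2$, $s_0<d/2$ and $ss_0\ge54$. Assume that the design matrix $X$ satisfies DSRIP$(s,s_0,\delta)$ with arbitrary $\delta\in(0,1)$. If the minimum signal strength $a>0$ satisfies $$a^2\le\frac{\sigma^2}{10n}\left(\frac{\log(m-s)}{s_0(1+\delta)}+\log(sd-ss_0)\right),$$ then $$\inf_{\hat\eta\in\{0,1\}^{d\times m}}\ \sup_{\beta^*\in\Theta_e(s,s_0,a)}\mathbf E_{Y\sim P_{\beta^*}}\Big\{\sum_{(i,j)\in[d]\times[m]}|\hat\eta_{ij}-\eta^*_{ij}|\Big\}\ge\frac{(ss_0)^{4/5}}{10},$$ or $$\inf_{\hat\eta_G\in\{0,1\}^m}\ \sup_{\beta^*\in\Theta_e(s,s_0,a)}\mathbf E_{Y\sim P_{\beta^*}}\Big\{\sum_{j\in[m]}|(\hat\eta_G)_j-(\eta^*_G)_j|\Big\}\ge\frac{s^{7/10}}{20}.$$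
   Context: **Model.** $n,m,d,s,s_0$ are positive integers, $p=md$, $\sigma>0$. The $p$ coordinates are partitioned into $m$ disjoint groups $G_1,\dots,G_m$ of size $d$; $(i,j)\in[d]\times[m]$ denotes the $i$-th coordinate of group $G_j$ ($[k]=\{1,\dots,k\}$). $X\in\mathbb R^{n\times p}$ is a fixed design whose columns $X_{(ij)}$ satisfy $\|X_{(ij)}\|_2=\sqrt n$. $P_{\beta^*}$ denotes the law $N(X\beta^*,\sigma^2I_n)$ of $Y$. **Parameter spaces.** $\Theta(s,s_0)=\{\beta\in\mathbb R^p:\sum_{j=1}^m\mathbf 1(\beta_{G_j}\ne\mathbf 0_d)\le s,\ \|\beta\|_0\le ss_0\}$ ($\|\beta\|_0$ is the number of nonzero entries), and $\Theta_e(s,s_0,a)=\{\beta\in\Theta(s,s_0):\min_{(i,j)\in\mathrm{supp}(\beta)}|\beta_{ij}|\ge a\}$, where $\mathrm{supp}(\beta)=\{(i,j):\beta_{ij}\ne0\}$. $\mathcal S(s,s_0)=\{\mathrm{supp}(\beta):\beta\in\Theta(s,s_0)\}$. **DSRIP.** $X$ satisfies DSRIP$(s,s_0,\delta)$ if $n(1-\delta)\|u\|_2^2\le\|X_Su\|_2^2\le n(1+\delta)\|u\|_2^2$ for all $S\in\mathcal S(s,s_0)$ and all nonzero $u\in\mathbb R^{|S|}$, where $X_S$ is the submatrix of columns indexed by $S$. **Selectors.** $\eta^*_{ij}=\mathbf 1(\beta^*_{ij}\ne0)$, $(\eta^*_G)_j=\mathbf 1(\beta^*_{G_j}\ne\mathbf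 0_d)$. The infima are over all (measurable) selectors $\hat\eta=\hat\eta(Y,X)\in\{0,1\}^{d\times m}$, respectively $\hat\eta_G=\hat\eta_G(Y,X)\in\{0,1\}^m$. *)

theory Defs
  imports "HOL-Probability.Probability"
begin

text \<open>
  The numbers \<open>n\<close>, \<open>d\<close>, \<open>m\<close> are the cardinalities of the finite index types \<open>'n\<close>, \<open>'d\<close>, \<open>'m\<close>;
  a coordinate is a pair \<open>(i, j)\<close>, the \<open>i\<close>-th coordinate of the \<open>j\<close>-th group.
\<close>

definition group_part :: "real ^ ('d::finite \<times> 'm::finite) \<Rightarrow> 'm \<Rightarrow> real ^ 'd"
  where "group_part \<beta> j = (\<chi> i. \<beta> $ (i, j))"

definition supp :: "real ^ 'k::finite \<Rightarrow> 'k set"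
  where "supp \<beta> = {k. \<beta> $ k \<noteq> 0}"

definition Theta :: "nat \<Rightarrow> nat \<Rightarrow> (real ^ ('d::finite \<times> 'm::finite)) set"
  where "Theta s s0 = {\<beta>. card {j. group_part \<beta> j \<noteq> 0} \<le> s \<and> card (supp \<beta>) \<le> s * s0}"

text \<open>The minimum over the empty support is read as \<open>\<infinity>\<close>, so \<open>0\<close> belongs to \<open>Theta_e s s0 a\<close>.\<close>

definition Theta_e :: "nat \<Rightarrow> nat \<Rightarrow> real \<Rightarrow> (real ^ ('d::finite \<times> 'm::finite)) set"
  where "Theta_e s s0 a = {\<beta> \<in> Theta s s0. \<forall>k\<in>supp \<beta>. \<bar>\<beta> $ k\<bar> \<ge> a}"

definition ds_supports :: "nat \<Rightarrow> nat \<Rightarrow> ('d::finite \<times> 'm::finite) set set"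
  where "ds_supports s s0 = supp ` Theta s s0"

text \<open>
  A vector of dimension \<open>card S\<close> is a function \<open>u\<close> of which only the values on \<open>S\<close> matter;
  \<open>L2_set u S\<close> is its Euclidean norm, and the sum of columns is the product of \<open>u\<close> with the
  submatrix of the columns in \<open>S\<close>.
\<close>

definition DSRIP ::
    "real ^ ('d::finite \<times> 'm::finite) ^ 'n::finite \<Rightarrow> nat \<Rightarrow> nat \<Rightarrow> real \<Rightarrow> bool"
  where "DSRIP X s s0 \<delta> \<longleftrightarrow>
    (\<forall>S\<in>ds_supports s s0. \<forall>u :: 'd \<times> 'm \<Rightarrow> real. (\<exists>k\<in>S. u k \<noteq> 0) \<longrightarrow>
      real CARD('n) * (1 - \<delta>) * (L2_set u S)\<^sup>2 \<le> (norm (\<Sum>k\<in>S. u k *\<^sub>R column k X))\<^sup>2 \<and>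
      (norm (\<Sum>k\<in>S. u k *\<^sub>R column k X))\<^sup>2 \<le> real CARD('n) * (1 + \<delta>) * (L2_set u S)\<^sup>2)"

definition std_normal_noise :: "('n::finite \<Rightarrow> real) measure"
  where "std_normal_noise = (\<Pi>\<^sub>M i\<in>UNIV. density lborel std_normal_density)"

text \<open>The law of \<open>Y = X \<beta> + \<sigma> \<xi>\<close> with i.i.d. standard normal coordinates of \<open>\<xi>\<close>.\<close>

definition obs_law ::
    "real ^ 'k::finite ^ 'n::finite \<Rightarrow> real \<Rightarrow> real ^ 'k \<Rightarrow> (real ^ 'n) measure"
  where "obs_law X \<sigma> \<beta> =
    distr std_normal_noise borel (\<lambda>\<xi>. X *v \<beta> + \<sigma> *\<^sub>R (\<chi> i. \<xi> i))"

definition eta :: "real ^ 'k::finite \<Rightarrow> real ^ 'k"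
  where "eta \<beta> = (\<chi> k. of_bool (\<beta> $ k \<noteq> 0))"

definition eta_group :: "real ^ ('d::finite \<times> 'm::finite) \<Rightarrow> real ^ 'm"
  where "eta_group \<beta> = (\<chi> j. of_bool (group_part \<beta> j \<noteq> 0))"

text \<open>
  The design is fixed, so a selector \<open>\<eta>(Y, X)\<close> is a measurable function of \<open>Y\<close> alone.
\<close>

definition selectors :: "(real ^ 'n::finite \<Rightarrow> real ^ 'k::finite) set"
  where "selectors = {f \<in> borel_measurable borel. \<forall>y k. f y $ k \<in> {0, 1}}"

definition hamming_risk ::
    "(real ^ 'n::finite) measure \<Rightarrow> (real ^ 'n \<Rightarrow> real ^ 'k::finite) \<Rightarrow> real ^ 'k \<Rightarrow> ennreal"
  where "hamming_risk P f \<eta> = (\<integral>\<^sup>+ y. ennreal (\<Sum>k\<in>UNIV. \<bar>f y $ k - \<eta> $ k\<bar>) \<partial>P)"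

end

theory Submission
  imports Defs
begin

text \<open>
  Both risks are instances of one problem. Directions \<open>u i\<close>, \<open>i \<in> I\<close>, are known, and a set \<open>S\<close> of at most
  \<open>k\<close> indices is to be recovered from the sum of the directions in \<open>S\<close> plus standard Gaussian noise. If
  \<open>25 \<le> k\<close>, \<open>2 * k < card I\<close> and every squared length is at most \<open>ln (card I - k) / 5\<close>, then each
  procedure makes, for some \<open>S\<close>, at least \<open>k powr (4/5) / 10\<close> wrong decisions on average
  (\<open>sparse_selection_risk\<close>).

  The sum of the two logarithmic terms in the condition on \<open>a\<close> is at most twice the larger one, which
  turns the constant \<open>1/10\<close> into \<open>1/5\<close>. If the larger one is \<open>ln (s * d - s * s0)\<close>, let \<open>I\<close> consist of the
  coordinates in \<open>s\<close> fixed groups, let \<open>k = s * s0\<close>, and let the directions be the columns of \<open>X\<close>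
  times \<open>a / \<sigma>\<close>; their lengths are given. Otherwise let \<open>I\<close> be the set of groups and \<open>k = s\<close>, and let a
  group contribute the sum of \<open>s0\<close> of its columns, times \<open>a / \<sigma>\<close>; DSRIP bounds the length
  (\<open>DSRIP_group_norm\<close>). Here the resulting bound is stronger than the one claimed, because \<open>s\<close> has the
  larger exponent \<open>4/5\<close>.

  The selection problem is bounded by a Bayes risk. Under the prior, \<open>S\<close> is built from independent
  uniform choices, one in each of \<open>k\<close> blocks, so the risk of a block can be computed with the other
  choices revealed (\<open>exists_hard_configuration\<close>). Two priors are needed. If \<open>card I\<close> is at most of the
  order \<open>k powr 4\<close>, \<open>k\<close> fixed indices are switched on or off, and the Hellinger affinity of two
  Gaussians bounds the error of each test (\<open>two_point_error\<close>). If \<open>card I\<close> is larger, each of \<open>k\<close> large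
  blocks contains one element of \<open>S\<close>, and the second moment of the likelihood ratio shows that this
  element is rarely found (\<open>multiple_testing_success\<close>). Both bounds rest on the explicit means of the
  powers of a Gaussian likelihood ratio (\<open>has_bochner_integral_lik_powr\<close>).
\<close>

section \<open>Shifts of a Gaussian vector and their likelihood ratios\<close>

definition std_gauss :: "(real ^ 'n::finite) measure"
  where "std_gauss = distr std_normal_noise borel (\<lambda>\<xi>. \<chi> i. \<xi> i)"

lemma measurable_vec_lambda_PiM:
  "(\<lambda>\<xi>. \<chi> i. \<xi> i) \<in> (\<Pi>\<^sub>M i\<in>(UNIV :: 'n::finite set). density lborel std_normal_density)
     \<rightarrow>\<^sub>M (borel :: (real ^ 'n) measure)"
proof -
  have eq: "(\<lambda>\<xi>. \<chi> i. \<xi> i) = (\<lambda>\<xi> :: 'n \<Rightarrow> real. \<Sum>i\<in>UNIV. \<xi> i *\<^sub>R axis i 1)"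
    by (auto simp: vec_eq_iff fun_eq_iff axis_def if_distrib cong: if_cong)
  show ?thesis
    unfolding eq by measurable
qed

lemma sets_std_gauss [measurable_cong, simp]: "sets std_gauss = sets borel"
  and space_std_gauss [simp]: "space std_gauss = UNIV"
  by (simp_all add: std_gauss_def)

lemma prob_space_std_gauss: "prob_space (std_gauss :: (real ^ 'n::finite) measure)"
proof -
  interpret P: prob_space "std_normal_noise :: ('n \<Rightarrow> real) measure"
    unfolding std_normal_noise_def by (intro prob_space_PiM prob_space_normal_density) simp
  show ?thesis
    unfolding std_gauss_def
    by (rule P.prob_space_distr) (simp add: std_normal_noise_def measurable_vec_lambda_PiM)
qed

text \<open>
  Completing the square: the standard normal density at \<open>x - u\<close> is its value at \<open>x\<close> times the
  stated exponential.
\<close>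

lemma nn_integral_normal_shift:
  fixes h :: "real \<Rightarrow> ennreal"
  assumes [measurable]: "h \<in> borel_measurable borel"
  shows "(\<integral>\<^sup>+ x. h (x + u) \<partial>density lborel std_normal_density)
       = (\<integral>\<^sup>+ x. ennreal (exp (u * x - u\<^sup>2 / 2)) * h x \<partial>density lborel std_normal_density)"
proof -
  have dens: "std_normal_density (x - u) = std_normal_density x * exp (u * x - u\<^sup>2 / 2)" for x :: real
    by (simp add: std_normal_density_def exp_add [symmetric] power2_eq_square field_simps)
  have "(\<integral>\<^sup>+ x. h (x + u) \<partial>density lborel std_normal_density)
      = (\<integral>\<^sup>+ x. ennreal (std_normal_density x) * h (x + u) \<partial>lborel)"
    by (simp add: nn_integral_density)
  also have "\<dots> = (\<integral>\<^sup>+ x. ennreal (std_normal_density (x - u)) * h x \<partial>lborel)"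
    using nn_integral_real_affine [of "\<lambda>x. ennreal (std_normal_density (x - u)) * h x" 1 u]
    by (simp add: add.commute)
  also have "\<dots> = (\<integral>\<^sup>+ x. ennreal (std_normal_density x) * (ennreal (exp (u * x - u\<^sup>2 / 2)) * h x) \<partial>lborel)"
    by (simp add: dens ennreal_mult mult.assoc)
  also have "\<dots> = (\<integral>\<^sup>+ x. ennreal (exp (u * x - u\<^sup>2 / 2)) * h x \<partial>density lborel std_normal_density)"
    by (simp add: nn_integral_density)
  finally show ?thesis .
qed

text \<open>
  Both sides are product measures with the same factors, so it is enough to compare them on boxes.
  On a box each side factorises and the one-dimensional shift formula applies to every coordinate.
\<close>

lemma distr_noise_shift:
  fixes u :: "'n::finite \<Rightarrow> real"
  defines "N \<equiv> \<Pi>\<^sub>M i\<in>(UNIV :: 'n set). density lborel std_normal_density"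
  shows "distr N N (\<lambda>x i. x i + u i)
       = density N (\<lambda>x. \<Prod>i\<in>UNIV. ennreal (exp (u i * x i - (u i)\<^sup>2 / 2)))"
proof -
  let ?K = "density lborel std_normal_density :: real measure"
  interpret K: prob_space ?K by (rule prob_space_normal_density) simp
  interpret PK: product_sigma_finite "\<lambda>_ :: 'n. ?K" ..
  define D where "D i = distr ?K borel (\<lambda>x. x + u i)" for i
  have D: "prob_space (D i)" for i
    unfolding D_def by (rule K.prob_space_distr) simp
  interpret PD: product_sigma_finite D
    using D by (simp add: product_sigma_finite_def prob_space_imp_sigma_finite)
  have sets_D: "sets (Pi\<^sub>M UNIV D) = sets N"
    unfolding N_def by (rule sets_PiM_cong) (simp_all add: D_def)
  have shift_meas: "(\<lambda>x i. x i + u i) \<in> N \<rightarrow>\<^sub>M N"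
    unfolding N_def by (rule measurable_PiM_single') (auto simp: space_PiM)
  have D_nn: "emeasure (D i) A = (\<integral>\<^sup>+ x. ennreal (exp (u i * x - (u i)\<^sup>2 / 2)) * indicator A x \<partial>?K)"
    if [measurable]: "A \<in> sets borel" for A i
  proof -
    have "emeasure (D i) A = (\<integral>\<^sup>+ x. indicator A x \<partial>D i)"
      by (simp add: D_def)
    also have "\<dots> = (\<integral>\<^sup>+ x. indicator A (x + u i) \<partial>?K)"
      unfolding D_def by (rule nn_integral_distr) auto
    also have "\<dots> = (\<integral>\<^sup>+ x. ennreal (exp (u i * x - (u i)\<^sup>2 / 2)) * indicator A x \<partial>?K)"
      by (rule nn_integral_normal_shift) auto
    finally show ?thesis .
  qed
  have 1: "distr N N (\<lambda>x i. x i + u i) = Pi\<^sub>M UNIV D"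
  proof (rule PD.PiM_eqI)
    fix A assume A: "\<And>i. i \<in> UNIV \<Longrightarrow> A i \<in> sets (D i)"
    then have A': "A i \<in> sets borel" for i by (simp add: D_def)
    have "emeasure (distr N N (\<lambda>x i. x i + u i)) (Pi\<^sub>E UNIV A)
        = emeasure N ((\<lambda>x i. x i + u i) -` Pi\<^sub>E UNIV A \<inter> space N)"
      using shift_meas A' by (intro emeasure_distr) (auto simp: N_def)
    also have "(\<lambda>x i. x i + u i) -` Pi\<^sub>E UNIV A \<inter> space N = Pi\<^sub>E UNIV (\<lambda>i. (\<lambda>x. x + u i) -` A i)"
      by (auto simp: N_def space_PiM PiE_def Pi_def)
    also have "emeasure N \<dots> = (\<Prod>i\<in>UNIV. emeasure ?K ((\<lambda>x. x + u i) -` A i))"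
      unfolding N_def
    proof (rule PK.emeasure_PiM)
      fix i show "(\<lambda>x. x + u i) -` A i \<in> sets ?K"
        using measurable_sets [of "\<lambda>x. x + u i" borel borel "A i"] A' by simp
    qed simp
    also have "\<dots> = (\<Prod>i\<in>UNIV. emeasure (D i) (A i))"
      unfolding D_def using A' by (simp add: emeasure_distr)
    finally show "emeasure (distr N N (\<lambda>x i. x i + u i)) (Pi\<^sub>E UNIV A)
        = (\<Prod>i\<in>UNIV. emeasure (D i) (A i))" .
  qed (simp_all add: sets_D)
  have 2: "density N (\<lambda>x. \<Prod>i\<in>UNIV. ennreal (exp (u i * x i - (u i)\<^sup>2 / 2))) = Pi\<^sub>M UNIV D"
  proof (rule PD.PiM_eqI)
    fix A assume A: "\<And>i. i \<in> UNIV \<Longrightarrow> A i \<in> sets (D i)"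
    then have A' [measurable]: "A i \<in> sets borel" for i by (simp add: D_def)
    have "emeasure (density N (\<lambda>x. \<Prod>i\<in>UNIV. ennreal (exp (u i * x i - (u i)\<^sup>2 / 2)))) (Pi\<^sub>E UNIV A)
        = (\<integral>\<^sup>+ x. (\<Prod>i\<in>UNIV. ennreal (exp (u i * x i - (u i)\<^sup>2 / 2))) * indicator (Pi\<^sub>E UNIV A) x \<partial>N)"
      using A' unfolding N_def
      by (intro emeasure_density) (auto intro!: sets_PiM_I_finite)
    also have "\<dots> = (\<integral>\<^sup>+ x. (\<Prod>i\<in>UNIV. ennreal (exp (u i * x i - (u i)\<^sup>2 / 2)) * indicator (A i) (x i)) \<partial>N)"
    proof (rule nn_integral_cong)
      fix x :: "'n \<Rightarrow> real"
      have "(indicator (Pi\<^sub>E UNIV A) x :: ennreal) = (\<Prod>i\<in>UNIV. indicator (A i) (x i))"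
        by (auto simp: indicator_def PiE_def Pi_def of_bool_def prod_zero_iff)
      then show "(\<Prod>i\<in>UNIV. ennreal (exp (u i * x i - (u i)\<^sup>2 / 2))) * indicator (Pi\<^sub>E UNIV A) x
          = (\<Prod>i\<in>UNIV. ennreal (exp (u i * x i - (u i)\<^sup>2 / 2)) * indicator (A i) (x i))"
        by (simp add: prod.distrib)
    qed
    also have "\<dots> = (\<Prod>i\<in>UNIV. \<integral>\<^sup>+ x. ennreal (exp (u i * x - (u i)\<^sup>2 / 2)) * indicator (A i) x \<partial>?K)"
      unfolding N_def
      by (rule PK.product_nn_integral_prod [where f = "\<lambda>i x. ennreal (exp (u i * x - (u i)\<^sup>2 / 2)) * indicator (A i) x"])
        auto
    also have "\<dots> = (\<Prod>i\<in>UNIV. emeasure (D i) (A i))"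
      by (simp add: D_nn)
    finally show "emeasure (density N (\<lambda>x. \<Prod>i\<in>UNIV. ennreal (exp (u i * x i - (u i)\<^sup>2 / 2)))) (Pi\<^sub>E UNIV A)
        = (\<Prod>i\<in>UNIV. emeasure (D i) (A i))" .
  qed (simp_all add: sets_D)
  from 1 2 show ?thesis by simp
qed

text \<open>
  The density at \<open>z\<close> of the standard Gaussian vector recentred at \<open>u\<close>, relative to the one centred
  at the origin.
\<close>

definition lik :: "real ^ 'n::finite \<Rightarrow> real ^ 'n \<Rightarrow> real"
  where "lik u z = exp (u \<bullet> z - (norm u)\<^sup>2 / 2)"

lemma lik_pos [simp]: "0 < lik u z" and lik_nonneg [simp]: "0 \<le> lik u z"
  by (simp_all add: lik_def)

lemma borel_measurable_lik [measurable]: "lik u \<in> borel_measurable borel"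
  unfolding lik_def by measurable

lemma nn_integral_std_gauss_shift:
  fixes h :: "real ^ 'n::finite \<Rightarrow> ennreal"
  assumes h [measurable]: "h \<in> borel_measurable borel"
  shows "(\<integral>\<^sup>+ z. h (z + u) \<partial>std_gauss) = (\<integral>\<^sup>+ z. ennreal (lik u z) * h z \<partial>std_gauss)"
proof -
  define N where "N = (\<Pi>\<^sub>M i\<in>(UNIV :: 'n set). density lborel std_normal_density)"
  define V where "V = (\<lambda>\<xi> :: 'n \<Rightarrow> real. \<chi> i. \<xi> i)"
  have V [measurable]: "V \<in> N \<rightarrow>\<^sub>M borel"
    unfolding V_def N_def by (rule measurable_vec_lambda_PiM)
  have gauss: "std_gauss = distr N borel V"
    by (simp add: std_gauss_def std_normal_noise_def N_def V_def)
  have shift: "(\<lambda>x i. x i + u $ i) \<in> N \<rightarrow>\<^sub>M N"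
    unfolding N_def by (rule measurable_PiM_single') (auto simp: space_PiM)
  have V_shift: "V (\<lambda>i. x i + u $ i) = V x + u" for x
    by (simp add: V_def vec_eq_iff)
  have lik_V: "ennreal (lik u (V x)) = (\<Prod>i\<in>UNIV. ennreal (exp (u $ i * x i - (u $ i)\<^sup>2 / 2)))" for x
    by (simp add: prod_ennreal lik_def V_def inner_vec_def power2_norm_eq_inner exp_sum [symmetric]
        sum_subtractf flip: sum_divide_distrib)
      (simp add: power2_eq_square)
  have "(\<integral>\<^sup>+ z. h (z + u) \<partial>std_gauss) = (\<integral>\<^sup>+ x. h (V (\<lambda>i. x i + u $ i)) \<partial>N)"
    unfolding gauss
    by (subst nn_integral_distr) (simp_all add: V_shift)
  also have "\<dots> = (\<integral>\<^sup>+ x. h (V x) \<partial>distr N N (\<lambda>x i. x i + u $ i))"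
    using shift by (subst nn_integral_distr) auto
  also have "\<dots> = (\<integral>\<^sup>+ x. h (V x) \<partial>density N (\<lambda>x. ennreal (lik u (V x))))"
    unfolding N_def distr_noise_shift lik_V ..
  also have "\<dots> = (\<integral>\<^sup>+ x. ennreal (lik u (V x)) * h (V x) \<partial>N)"
    by (rule nn_integral_density) auto
  also have "\<dots> = (\<integral>\<^sup>+ z. ennreal (lik u z) * h z \<partial>std_gauss)"
    unfolding gauss by (subst nn_integral_distr) auto
  finally show ?thesis .
qed

lemma has_bochner_integral_exp_inner_std_gauss:
  fixes u :: "real ^ 'n::finite"
  shows "has_bochner_integral std_gauss (\<lambda>z. exp (u \<bullet> z)) (exp ((norm u)\<^sup>2 / 2))"
proof (rule has_bochner_integral_nn_integral)
  interpret prob_space "std_gauss :: (real ^ 'n) measure" by (rule prob_space_std_gauss)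
  have "(\<integral>\<^sup>+ z. ennreal (exp (u \<bullet> z)) \<partial>std_gauss)
      = (\<integral>\<^sup>+ z. ennreal (exp ((norm u)\<^sup>2 / 2)) * (ennreal (lik u z) * 1) \<partial>std_gauss)"
    by (simp add: lik_def ennreal_mult [symmetric] exp_add [symmetric])
  also have "\<dots> = ennreal (exp ((norm u)\<^sup>2 / 2)) * (\<integral>\<^sup>+ z. 1 \<partial>(std_gauss :: (real ^ 'n) measure))"
    using nn_integral_std_gauss_shift [of "\<lambda>_. 1" u] by (subst nn_integral_cmult) simp_all
  also have "\<dots> = ennreal (exp ((norm u)\<^sup>2 / 2))"
    using emeasure_space_1 by simp
  finally show "(\<integral>\<^sup>+ z. ennreal (exp (u \<bullet> z)) \<partial>std_gauss) = ennreal (exp ((norm u)\<^sup>2 / 2))" .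
qed auto

text \<open>
  All moments of the likelihood ratio that the testing bounds below need. The exponent \<open>1/2\<close>
  gives the Hellinger affinity of two shifted Gaussians, the exponent \<open>2\<close> the second moment of the
  likelihood ratio.
\<close>

lemma has_bochner_integral_lik_powr:
  fixes u :: "real ^ 'n::finite"
  shows "has_bochner_integral std_gauss (\<lambda>z. lik u z powr r) (exp ((r\<^sup>2 - r) / 2 * (norm u)\<^sup>2))"
proof -
  have "(\<lambda>z. lik u z powr r) = (\<lambda>z. exp (- r * (norm u)\<^sup>2 / 2) * exp ((r *\<^sub>R u) \<bullet> z))"
    by (auto simp: lik_def powr_def exp_add [symmetric] algebra_simps)
  moreover have "exp ((r\<^sup>2 - r) / 2 * (norm u)\<^sup>2)
      = exp (- r * (norm u)\<^sup>2 / 2) * exp ((norm (r *\<^sub>R u))\<^sup>2 / 2)"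
    by (simp add: exp_add [symmetric] field_simps power_mult_distrib)
  ultimately show ?thesis
    using has_bochner_integral_mult_right [OF has_bochner_integral_exp_inner_std_gauss [of "r *\<^sub>R u"]]
    by simp
qed

lemma has_bochner_integral_indicator_lik:
  fixes A :: "(real ^ 'n::finite) set"
  assumes [measurable]: "A \<in> sets borel"
  shows "has_bochner_integral std_gauss (\<lambda>z. indicator A z * lik u z) (measure std_gauss {z. z + u \<in> A})"
proof (rule has_bochner_integral_nn_integral)
  interpret prob_space "std_gauss :: (real ^ 'n) measure" by (rule prob_space_std_gauss)
  have "(\<integral>\<^sup>+ z. ennreal (indicator A z * lik u z) \<partial>std_gauss)
      = (\<integral>\<^sup>+ z. ennreal (lik u z) * indicator A z \<partial>std_gauss)"
    by (intro nn_integral_cong) (auto simp: indicator_def)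
  also have "\<dots> = (\<integral>\<^sup>+ z. indicator A (z + u) \<partial>std_gauss)"
    by (rule nn_integral_std_gauss_shift [symmetric]) auto
  also have "\<dots> = (\<integral>\<^sup>+ z. indicator {z. z + u \<in> A} z \<partial>std_gauss)"
    by (intro nn_integral_cong) (auto simp: indicator_def)
  also have "\<dots> = emeasure std_gauss {z. z + u \<in> A}"
    by (rule nn_integral_indicator) simp
  finally show "(\<integral>\<^sup>+ z. ennreal (indicator A z * lik u z) \<partial>std_gauss)
      = ennreal (measure std_gauss {z. z + u \<in> A})"
    by (simp add: emeasure_eq_measure)
qed auto

section \<open>Two testing bounds\<close>

text \<open>
  The sum of the two errors of any test is at least the integral of the minimum of the two
  densities, which the affinity \<open>q\<close> controls from below. Usually this uses the Cauchy--Schwarz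
  inequality; here the pointwise bound \<open>min 1 l \<ge> q \<surd>l - (q/2)\<^sup>2 (1 + l)\<close>, which is linear in
  \<open>\<surd>l\<close> and \<open>l\<close>, can be integrated directly and yields \<open>q\<^sup>2 / 2\<close>. The common shift
  \<open>c\<close> stands for the part of the signal that is revealed to the test.
\<close>

lemma two_point_error:
  fixes A :: "(real ^ 'n::finite) set"
  assumes A: "A \<in> sets borel"
  shows "exp (- (norm u)\<^sup>2 / 4) / 2
    \<le> measure std_gauss {z. z + c \<in> A} + measure std_gauss {z. z + (c + u) \<notin> A}"
proof -
  interpret prob_space "std_gauss :: (real ^ 'n) measure" by (rule prob_space_std_gauss)
  define B where "B = {z. z + c \<in> A}"
  have B [measurable]: "B \<in> sets borel"
    using A unfolding B_def by measurable
  define q where "q = exp (- (norm u)\<^sup>2 / 8)"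
  have root: "has_bochner_integral std_gauss (\<lambda>z. lik u z powr (1/2)) q"
    using has_bochner_integral_lik_powr [of u "1/2"] by (simp add: q_def power2_eq_square)
  have one: "has_bochner_integral std_gauss (lik u) 1"
    using has_bochner_integral_lik_powr [of u 1] by simp
  have const: "has_bochner_integral std_gauss (\<lambda>z :: real ^ 'n. 1 :: real) 1"
    using emeasure_space_1 has_bochner_integral_real_indicator [of UNIV "std_gauss :: (real ^ 'n) measure"]
    by (simp add: measure_def)
  have ind: "has_bochner_integral std_gauss (indicat_real B) (measure std_gauss B)"
    by (rule has_bochner_integral_real_indicator) (auto simp: emeasure_eq_measure)
  have lower: "has_bochner_integral std_gauss
      (\<lambda>z. q * lik u z powr (1/2) - (q/2)\<^sup>2 * (1 + lik u z)) (q * q - (q/2)\<^sup>2 * (1 + 1))"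
    by (intro has_bochner_integral_diff has_bochner_integral_mult_right has_bochner_integral_add root one const)
  have upper: "has_bochner_integral std_gauss (\<lambda>z. indicat_real B z + indicator (- B) z * lik u z)
      (measure std_gauss B + measure std_gauss {z. z + u \<in> - B})"
    by (intro has_bochner_integral_add ind has_bochner_integral_indicator_lik) simp
  have "q * lik u z powr (1/2) - (q/2)\<^sup>2 * (1 + lik u z)
      \<le> indicat_real B z + indicator (- B) z * lik u z" for z
  proof -
    define r where "r = lik u z powr (1/2)"
    have lik: "lik u z = r\<^sup>2"
      by (simp add: r_def powr_half_sqrt)
    \<comment> \<open>With \<open>r = \<surd>l\<close>, completing the square against \<open>1\<close> and against \<open>l\<close>.\<close>
    have "q * r - (q/2)\<^sup>2 * (1 + r\<^sup>2) = 1 - (1 - q/2 * r)\<^sup>2 - (q/2)\<^sup>2"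
         "q * r - (q/2)\<^sup>2 * (1 + r\<^sup>2) = r\<^sup>2 - (r - q/2)\<^sup>2 - (q/2 * r)\<^sup>2"
      by (simp_all add: power2_eq_square field_simps)
    then have "q * r - (q/2)\<^sup>2 * (1 + r\<^sup>2) \<le> 1" "q * r - (q/2)\<^sup>2 * (1 + r\<^sup>2) \<le> r\<^sup>2"
      by (smt (verit) zero_le_power2)+
    then show ?thesis
      unfolding r_def [symmetric] unfolding lik by (cases "z \<in> B") simp_all
  qed
  then have "q * q - (q/2)\<^sup>2 * (1 + 1) \<le> measure std_gauss B + measure std_gauss {z. z + u \<in> - B}"
    using lower upper
    by (metis (no_types, lifting) has_bochner_integral_integral_eq has_bochner_integral_iff integral_mono)
  also have "{z. z + u \<in> - B} = {z. z + (c + u) \<notin> A}"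
    by (simp add: B_def algebra_simps)
  also have "q * q - (q/2)\<^sup>2 * (1 + 1) = exp (- (norm u)\<^sup>2 / 4) / 2"
    by (simp add: q_def power2_eq_square exp_add [symmetric])
  finally show ?thesis
    by (simp add: B_def)
qed

text \<open>
  At most one of the likelihood ratios \<open>l\<close> is counted at each point, because the decision regions are
  disjoint. It is bounded by \<open>(t + l\<^sup>2 / t) / 2\<close>, and then by the same expression with \<open>l\<^sup>2\<close>
  replaced by the sum of all squares. So a correct guess among many hypotheses is rare as soon as the
  second moments are small compared with the number of hypotheses.
\<close>

lemma multiple_testing_success:
  fixes u :: "'x \<Rightarrow> real ^ 'n::finite"
  assumes C: "finite C" and A: "\<And>x. x \<in> C \<Longrightarrow> A x \<in> sets borel"
    and disj: "disjoint_family_on A C" and t: "0 < t"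
  shows "(\<Sum>x\<in>C. measure std_gauss {z. z + u x \<in> A x}) \<le> (t + (\<Sum>x\<in>C. exp ((norm (u x))\<^sup>2)) / t) / 2"
proof -
  interpret prob_space "std_gauss :: (real ^ 'n) measure" by (rule prob_space_std_gauss)
  have const: "has_bochner_integral std_gauss (\<lambda>z :: real ^ 'n. 1 :: real) 1"
    using emeasure_space_1 has_bochner_integral_real_indicator [of UNIV "std_gauss :: (real ^ 'n) measure"]
    by (simp add: measure_def)
  have square: "has_bochner_integral std_gauss (\<lambda>z. (lik (u x) z)\<^sup>2) (exp ((norm (u x))\<^sup>2))" for x
    using has_bochner_integral_lik_powr [of "u x" 2] by simp
  have lower: "has_bochner_integral std_gauss (\<lambda>z. \<Sum>x\<in>C. indicator (A x) z * lik (u x) z)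
      (\<Sum>x\<in>C. measure std_gauss {z. z + u x \<in> A x})"
    by (intro has_bochner_integral_sum has_bochner_integral_indicator_lik A)
  have upper: "has_bochner_integral std_gauss
      (\<lambda>z. (1/2) * (t * 1 + (1/t) * (\<Sum>x\<in>C. (lik (u x) z)\<^sup>2)))
      ((1/2) * (t * 1 + (1/t) * (\<Sum>x\<in>C. exp ((norm (u x))\<^sup>2))))"
    by (intro has_bochner_integral_mult_right has_bochner_integral_add has_bochner_integral_sum
        square const)
  have "(\<Sum>x\<in>C. indicator (A x) z * lik (u x) z)
      \<le> (1/2) * (t * 1 + (1/t) * (\<Sum>x\<in>C. (lik (u x) z)\<^sup>2))" for z
  proof (cases "\<exists>x\<in>C. z \<in> A x")
    case True
    then obtain x where x: "x \<in> C" "z \<in> A x" by blast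
    then have "z \<notin> A y" if "y \<in> C - {x}" for y
      using disj that by (auto simp: disjoint_family_on_def)
    then have "(\<Sum>x\<in>C. indicator (A x) z * lik (u x) z) = lik (u x) z"
      using x C by (subst sum.remove [of C x]) auto
    moreover have "(lik (u x) z)\<^sup>2 \<le> (\<Sum>x\<in>C. (lik (u x) z)\<^sup>2)"
      using x C by (intro member_le_sum) auto
    moreover have "lik (u x) z \<le> (1/2) * (t + (1/t) * (lik (u x) z)\<^sup>2)"
    proof -
      have "0 \<le> (lik (u x) z - t)\<^sup>2 / (2 * t)"
        using t by simp
      also have "\<dots> = (1/2) * (t + (1/t) * (lik (u x) z)\<^sup>2) - lik (u x) z"
        using t by (simp add: power2_eq_square field_simps)
      finally show ?thesis by simp
    qed
    ultimately show ?thesis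
      using t by (smt (verit, best) divide_right_mono mult_left_mono zero_le_divide_iff)
  next
    case False
    then have "(\<Sum>x\<in>C. indicator (A x) z * lik (u x) z) = 0"
      by (intro sum.neutral) auto
    then show ?thesis
      using t by (simp add: sum_nonneg)
  qed
  then have "(\<Sum>x\<in>C. measure std_gauss {z. z + u x \<in> A x})
      \<le> (1/2) * (t * 1 + (1/t) * (\<Sum>x\<in>C. exp ((norm (u x))\<^sup>2)))"
    using lower upper
    by (metis (no_types, lifting) has_bochner_integral_integral_eq has_bochner_integral_iff integral_mono)
  then show ?thesis by simp
qed

section \<open>Independent uniform choices in several blocks\<close>

text \<open>
  Resampling one coordinate uniformly leaves the uniform distribution on configurations invariant.
\<close>

lemma sum_PiE_resample:
  fixes g :: "('b \<Rightarrow> 'x) \<Rightarrow> real"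
  assumes "finite K" "b \<in> K"
  shows "(\<Sum>c\<in>K \<rightarrow>\<^sub>E C. \<Sum>x\<in>C. g (c(b := x))) = real (card C) * (\<Sum>c\<in>K \<rightarrow>\<^sub>E C. g c)"
proof -
  define L where "L = K - {b}"
  have K: "K = insert b L" "b \<notin> L"
    using assms by (auto simp: L_def)
  have split: "(\<Sum>c\<in>K \<rightarrow>\<^sub>E C. F c) = (\<Sum>(x, c)\<in>C \<times> (L \<rightarrow>\<^sub>E C). F (c(b := x)))"
    for F :: "('b \<Rightarrow> 'x) \<Rightarrow> real"
    unfolding K(1) PiE_insert_eq
    by (subst sum.reindex [OF inj_combinator [OF K(2), of "\<lambda>_. C"]]) (simp add: case_prod_unfold)
  show ?thesis
    unfolding split
    by (simp add: sum.cartesian_product [symmetric] sum.swap [of _ C "L \<rightarrow>\<^sub>E C"])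
qed

text \<open>
  Assouad's argument: when the choices in the blocks are independent and uniform, the Bayes risk is
  the sum of the risks of the blocks, and the risk of one block can be bounded with all other choices
  revealed. Some configuration is at least as bad as the average one.
\<close>

lemma exists_hard_configuration:
  fixes r :: "'b \<Rightarrow> ('b \<Rightarrow> 'x) \<Rightarrow> real"
  assumes K: "finite K" and C: "finite C" "C \<noteq> {}"
    and r: "\<And>b c. b \<in> K \<Longrightarrow> c \<in> K \<rightarrow>\<^sub>E C \<Longrightarrow> real (card C) * \<epsilon> \<le> (\<Sum>x\<in>C. r b (c(b := x)))"
  shows "\<exists>c\<in>K \<rightarrow>\<^sub>E C. real (card K) * \<epsilon> \<le> (\<Sum>b\<in>K. r b c)"
proof (rule ccontr)
  let ?P = "K \<rightarrow>\<^sub>E C"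
  assume "\<not> ?thesis"
  then have less: "(\<Sum>b\<in>K. r b c) < real (card K) * \<epsilon>" if "c \<in> ?P" for c
    using that by force
  have fin: "finite ?P" and ne: "?P \<noteq> {}"
    using K C by (auto intro!: finite_PiE simp: PiE_eq_empty_iff)
  have "real (card ?P) * \<epsilon> \<le> (\<Sum>c\<in>?P. r b c)" if "b \<in> K" for b
  proof -
    have "real (card C) * (real (card ?P) * \<epsilon>) = (\<Sum>c\<in>?P. real (card C) * \<epsilon>)"
      by simp
    also have "\<dots> \<le> (\<Sum>c\<in>?P. \<Sum>x\<in>C. r b (c(b := x)))"
      using r that by (intro sum_mono) auto
    also have "\<dots> = real (card C) * (\<Sum>c\<in>?P. r b c)"
      using K that by (rule sum_PiE_resample)
    finally show ?thesis
      using C by (simp add: card_gt_0_iff)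
  qed
  then have "(\<Sum>b\<in>K. real (card ?P) * \<epsilon>) \<le> (\<Sum>b\<in>K. \<Sum>c\<in>?P. r b c)"
    by (rule sum_mono)
  also have "\<dots> = (\<Sum>c\<in>?P. \<Sum>b\<in>K. r b c)"
    by (rule sum.swap)
  also have "\<dots> < (\<Sum>c\<in>?P. real (card K) * \<epsilon>)"
    using fin ne less by (intro sum_strict_mono) auto
  finally show False
    by (simp add: algebra_simps)
qed

section \<open>Selecting a sparse set of directions\<close>

text \<open>
  A selection procedure is given by the regions \<open>A i\<close> of observations for which it reports \<open>i\<close>.
\<close>

definition sel_error ::
    "('i \<Rightarrow> (real ^ 'n::finite) set) \<Rightarrow> ('i \<Rightarrow> real ^ 'n) \<Rightarrow> 'i set \<Rightarrow> 'i \<Rightarrow> real"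
  where "sel_error A u S i = measure std_gauss {z. (z + (\<Sum>j\<in>S. u j) \<in> A i) \<noteq> (i \<in> S)}"

text \<open>
  The bound for sets that are not very sparse: under a uniformly random subset of \<open>K\<close>, each membership
  is a test between two Gaussians at distance \<open>norm (u i)\<close>.
\<close>

lemma subset_selection_risk:
  fixes u :: "'i \<Rightarrow> real ^ 'n::finite"
  assumes K: "finite K" and A: "\<And>i. i \<in> K \<Longrightarrow> A i \<in> sets borel"
    and u: "\<And>i. i \<in> K \<Longrightarrow> (norm (u i))\<^sup>2 \<le> \<tau>"
  shows "\<exists>S\<subseteq>K. real (card K) * (exp (- \<tau> / 4) / 4) \<le> (\<Sum>i\<in>K. sel_error A u S i)"
proof -
  define T where "T c = {b \<in> K. c b}" for c :: "'i \<Rightarrow> bool"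
  have "\<exists>c\<in>K \<rightarrow>\<^sub>E UNIV. real (card K) * (exp (- \<tau> / 4) / 4) \<le> (\<Sum>b\<in>K. sel_error A u (T c) b)"
  proof (rule exists_hard_configuration)
    fix b c assume b: "b \<in> K"
    define S where "S = T c - {b}"
    have S: "T (c(b := False)) = S" "T (c(b := True)) = insert b S" "b \<notin> S" "finite S"
      using b K by (auto simp: T_def S_def)
    have "exp (- \<tau> / 4) / 2 \<le> exp (- (norm (u b))\<^sup>2 / 4) / 2"
      using u [OF b] by simp
    also have "\<dots> \<le> sel_error A u S b + sel_error A u (insert b S) b"
      using two_point_error [OF A [OF b], of "u b" "\<Sum>j\<in>S. u j"] S
      by (simp add: sel_error_def add.commute add.left_commute)
    finally show "real (card (UNIV :: bool set)) * (exp (- \<tau> / 4) / 4)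
        \<le> (\<Sum>x\<in>UNIV. sel_error A u (T (c(b := x))) b)"
      using S by (simp add: UNIV_bool)
  qed (use K in auto)
  then show ?thesis
    unfolding T_def by (metis (no_types, lifting) mem_Collect_eq subsetI)
qed

text \<open>
  The bound for strongly sparse sets: \<open>S\<close> contains exactly one element, uniformly chosen, of each of the
  blocks \<open>e ` ({b} \<times> C)\<close>. Finding the element of one block, with all others known, is a multiple
  testing problem with \<open>card C\<close> hypotheses, and \<open>exp \<tau>\<close> bounds the second moments of the likelihood
  ratios. A block that is not recovered exactly contributes at least one wrong decision.
\<close>

lemma one_per_block_selection_risk:
  fixes u :: "'i \<Rightarrow> real ^ 'n::finite" and e :: "'b \<times> 'x \<Rightarrow> 'i"
  assumes K: "finite K" and C: "finite C" "C \<noteq> {}" and e: "inj_on e (K \<times> C)"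
    and A: "\<And>i. i \<in> e ` (K \<times> C) \<Longrightarrow> A i \<in> sets borel"
    and u: "\<And>i. i \<in> e ` (K \<times> C) \<Longrightarrow> (norm (u i))\<^sup>2 \<le> \<tau>"
    and \<tau>: "exp \<tau> \<le> real (card C) / 4"
  shows "\<exists>S\<subseteq>e ` (K \<times> C). card S \<le> card K \<and>
           real (card K) / 2 \<le> (\<Sum>i\<in>e ` (K \<times> C). sel_error A u S i)"
proof -
  interpret prob_space "std_gauss :: (real ^ 'n) measure" by (rule prob_space_std_gauss)
  define T where "T c = (\<lambda>b. e (b, c b)) ` K" for c
  define D where "D b x = {y. \<forall>x'\<in>C. (y \<in> A (e (b, x'))) \<longleftrightarrow> x' = x}" for b x
  define \<mu> where "\<mu> c = (\<Sum>b\<in>K. u (e (b, c b)))" for c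
  have D [measurable]: "D b x \<in> sets borel" if "b \<in> K" for b x
  proof -
    have [measurable]: "A (e (b, x')) \<in> sets borel" if "x' \<in> C" for x'
      using A that \<open>b \<in> K\<close> by blast
    show ?thesis
      using C unfolding D_def by measurable
  qed
  have "\<exists>c\<in>K \<rightarrow>\<^sub>E C. real (card K) * (1 / 2) \<le> (\<Sum>b\<in>K. measure std_gauss {z. z + \<mu> c \<notin> D b (c b)})"
  proof (rule exists_hard_configuration [OF K C])
    fix b c assume b: "b \<in> K" and c: "c \<in> K \<rightarrow>\<^sub>E C"
    define w where "w = (\<Sum>b'\<in>K - {b}. u (e (b', c b')))"
    have \<mu>: "\<mu> (c(b := x)) = u (e (b, x)) + w" for x
      unfolding \<mu>_def w_def using K b by (subst sum.remove [of K b]) (auto intro!: sum.cong)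
    have meas: "{z. z + w \<in> D b x} \<in> sets borel" for x
      using D [OF b] by measurable
    \<comment> \<open>With this \<open>t\<close> the two terms of the success bound are balanced in the worst case.\<close>
    define t where "t = real (card C) / 2"
    have t: "0 < t"
      using C by (simp add: t_def card_gt_0_iff)
    have "(\<Sum>x\<in>C. exp ((norm (u (e (b, x))))\<^sup>2)) / t \<le> (\<Sum>x\<in>C. exp \<tau>) / t"
      using t b u by (intro divide_right_mono sum_mono) auto
    also have "\<dots> \<le> real (card C) * (real (card C) / 4) / t"
      using mult_left_mono [OF \<tau>, of "real (card C)"] t by (intro divide_right_mono) auto
    also have "\<dots> = t"
      using t by (simp add: t_def field_simps)
    finally have bound: "(\<Sum>x\<in>C. exp ((norm (u (e (b, x))))\<^sup>2)) / t \<le> t" .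
    \<comment> \<open>In \<open>D b x\<close> the procedure reports exactly the element \<open>x\<close> of block \<open>b\<close>.\<close>
    have "disjoint_family_on (\<lambda>x. {z. z + w \<in> D b x}) C"
      by (auto simp: disjoint_family_on_def D_def)
    then have "(\<Sum>x\<in>C. measure std_gauss {z. z + u (e (b, x)) \<in> {z. z + w \<in> D b x}})
        \<le> (t + (\<Sum>x\<in>C. exp ((norm (u (e (b, x))))\<^sup>2)) / t) / 2"
      using meas C(1) t by (intro multiple_testing_success) auto
    also have "\<dots> \<le> t"
      using bound by simp
    finally have success: "(\<Sum>x\<in>C. measure std_gauss {z. z + \<mu> (c(b := x)) \<in> D b x}) \<le> t"
      by (simp add: \<mu> add.assoc)
    have "measure std_gauss {z. z + \<mu> (c(b := x)) \<notin> D b x}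
        = 1 - measure std_gauss {z. z + \<mu> (c(b := x)) \<in> D b x}" for x
    proof -
      have "{z. z + \<mu> (c(b := x)) \<in> D b x} \<in> events"
        using D [OF b] by measurable
      then show ?thesis
        using prob_compl [of "{z. z + \<mu> (c(b := x)) \<in> D b x}"] by (simp add: set_diff_eq)
    qed
    then show "real (card C) * (1 / 2)
        \<le> (\<Sum>x\<in>C. measure std_gauss {z. z + \<mu> (c(b := x)) \<notin> D b ((c(b := x)) b)})"
      using success by (simp add: sum_subtractf t_def)
  qed
  then obtain c where c: "c \<in> K \<rightarrow>\<^sub>E C"
    and risk: "real (card K) / 2 \<le> (\<Sum>b\<in>K. measure std_gauss {z. z + \<mu> c \<notin> D b (c b)})"
    by auto
  have cC: "c b \<in> C" if "b \<in> K" for b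
    using c that by auto
  have sum_T: "(\<Sum>j\<in>T c. u j) = \<mu> c"
  proof -
    have "inj_on (\<lambda>b. e (b, c b)) K"
      using e cC unfolding inj_on_def by blast
    then show ?thesis
      by (simp add: T_def \<mu>_def sum.reindex)
  qed
  have mem_T: "e (b, x) \<in> T c \<longleftrightarrow> x = c b" if "b \<in> K" "x \<in> C" for b x
  proof
    assume "e (b, x) \<in> T c"
    then obtain b' where "b' \<in> K" and "e (b, x) = e (b', c b')"
      by (auto simp: T_def)
    moreover have "(b, x) \<in> K \<times> C" "(b', c b') \<in> K \<times> C"
      using that cC \<open>b' \<in> K\<close> by auto
    ultimately have "(b, x) = (b', c b')"
      using e by (intro inj_onD [OF e])
    then show "x = c b" by simp
  qed (use that in \<open>simp add: T_def\<close>)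
  note risk
  also have "(\<Sum>b\<in>K. measure std_gauss {z. z + \<mu> c \<notin> D b (c b)})
      \<le> (\<Sum>b\<in>K. \<Sum>x\<in>C. sel_error A u (T c) (e (b, x)))"
  proof (rule sum_mono)
    fix b assume b: "b \<in> K"
    define F where "F x = {z. (z + \<mu> c \<in> A (e (b, x))) \<noteq> (x = c b)}" for x
    have F: "F x \<in> events" if "x \<in> C" for x
    proof -
      have [measurable]: "A (e (b, x)) \<in> sets borel"
        using A that b by blast
      show ?thesis
        unfolding F_def by measurable
    qed
    have "{z. z + \<mu> c \<notin> D b (c b)} = (\<Union>x\<in>C. F x)"
      by (auto simp: D_def F_def)
    also have "measure std_gauss \<dots> \<le> (\<Sum>x\<in>C. measure std_gauss (F x))"
      using C F by (intro finite_measure_subadditive_finite) auto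
    also have "\<dots> = (\<Sum>x\<in>C. sel_error A u (T c) (e (b, x)))"
      using b by (intro sum.cong) (simp_all add: sel_error_def F_def sum_T mem_T)
    finally show "measure std_gauss {z. z + \<mu> c \<notin> D b (c b)}
        \<le> (\<Sum>x\<in>C. sel_error A u (T c) (e (b, x)))" .
  qed
  also have "\<dots> = (\<Sum>i\<in>e ` (K \<times> C). sel_error A u (T c) i)"
    using e by (simp add: sum.reindex sum.cartesian_product case_prod_unfold)
  finally have "real (card K) / 2 \<le> (\<Sum>i\<in>e ` (K \<times> C). sel_error A u (T c) i)" .
  moreover have "T c \<subseteq> e ` (K \<times> C)" "card (T c) \<le> card K"
    using cC K by (auto simp: T_def intro: card_image_le)
  ultimately show ?thesis
    by blast
qed

text \<open>
  With \<open>M = card I - k\<close>, random subsets of a fixed set of \<open>k\<close> elements cost at least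
  \<open>k * M powr (- 1/20) / 4\<close> wrong decisions, which suffices while \<open>M \<le> k powr 4\<close>. For larger \<open>M\<close>, split \<open>I\<close> into
  \<open>k\<close> blocks of size at least \<open>M / k \<ge> M powr (3/4)\<close>. The second moments \<open>M powr (1/5)\<close> are negligible
  against this size, and at least half of the blocks are missed on average. Both priors are
  supported by sets with at most \<open>k\<close> elements, so no tail of a random cardinality has to be
  controlled.
\<close>

lemma sparse_selection_risk:
  fixes u :: "'i \<Rightarrow> real ^ 'n::finite"
  assumes I: "finite I" and A: "\<And>i. i \<in> I \<Longrightarrow> A i \<in> sets borel"
    and k: "25 \<le> k" "2 * k < card I"
    and u: "\<And>i. i \<in> I \<Longrightarrow> (norm (u i))\<^sup>2 \<le> ln (real (card I) - real k) / 5"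
  shows "\<exists>S\<subseteq>I. card S \<le> k \<and> real k powr (4/5) / 10 \<le> (\<Sum>i\<in>I. sel_error A u S i)"
proof -
  define M where "M = real (card I) - real k"
  have M: "real k < M"
    using k by (simp add: M_def)
  have k0: "0 < real k" and M0: "0 < M"
    using k M by simp_all
  have extend: ?thesis
    if "J \<subseteq> I" "S \<subseteq> J" "card S \<le> k" "real k powr (4/5) / 10 \<le> (\<Sum>i\<in>J. sel_error A u S i)" for J S
  proof -
    have "(\<Sum>i\<in>J. sel_error A u S i) \<le> (\<Sum>i\<in>I. sel_error A u S i)"
      using I that by (intro sum_mono2) (auto simp: sel_error_def)
    then show ?thesis
      using that by (intro exI [of _ S]) auto
  qed
  show ?thesis
  proof (cases "M \<le> real k powr 4")
    case True
    obtain K where K: "K \<subseteq> I" "card K = k"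
      using k obtain_subset_with_card_n [of k I] by auto
    have "\<exists>S\<subseteq>K. real (card K) * (exp (- (ln M / 5) / 4) / 4) \<le> (\<Sum>i\<in>K. sel_error A u S i)"
      using K I A u by (intro subset_selection_risk) (auto simp: M_def intro: finite_subset)
    then obtain S where S: "S \<subseteq> K" "real k * (exp (- (ln M / 5) / 4) / 4) \<le> (\<Sum>i\<in>K. sel_error A u S i)"
      using K by auto
    have "real k powr (- 1/5) = (real k powr 4) powr (- 1/20)"
      by (subst powr_powr) simp
    also have "\<dots> \<le> M powr (- 1/20)"
      using True M0 by (intro powr_mono2') auto
    also have "\<dots> = exp (- (ln M / 5) / 4)"
      using M0 by (simp add: powr_def)
    finally have exp: "real k powr (- 1/5) \<le> exp (- (ln M / 5) / 4)" .
    have "real k powr (4/5) = real k * real k powr (- 1/5)"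
      using k0 powr_add [of "real k" 1 "- 1/5"] by simp
    also have "\<dots> \<le> real k * exp (- (ln M / 5) / 4)"
      using exp k0 by simp
    finally have "real k powr (4/5) \<le> 4 * (real k * (exp (- (ln M / 5) / 4) / 4))"
      by simp
    also have "\<dots> \<le> 4 * (\<Sum>i\<in>K. sel_error A u S i)"
      using S(2) by simp
    finally have "real k powr (4/5) / 10 \<le> (\<Sum>i\<in>K. sel_error A u S i)"
      using powr_ge_zero [of "real k" "4/5"] by linarith
    moreover have "card S \<le> k"
      using card_mono [OF finite_subset [OF K(1) I] S(1)] K(2) by simp
    ultimately show ?thesis
      using extend K S by blast
  next
    case False
    define B where "B = card I div k"
    have "card I = k * B + card I mod k"
      by (simp add: B_def)
    moreover have "card I mod k < k"
      using k by (intro mod_less_divisor) simp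
    ultimately have "card I \<le> k * B + k"
      by linarith
    then have "real (card I) \<le> real (k * B + k)"
      by (rule of_nat_mono)
    then have "M \<le> real B * real k"
      by (simp add: M_def mult.commute)
    then have "M / real k \<le> real B"
      using k0 by (simp add: divide_le_eq)
    moreover have "M powr (3/4) \<le> M / real k"
    proof -
      have "real k = (real k powr 4) powr (1/4)"
        using k0 by (subst powr_powr) simp
      also have "\<dots> \<le> M powr (1/4)"
        using False by (intro powr_mono2) auto
      finally have "M powr (3/4) * real k \<le> M powr (3/4) * M powr (1/4)"
        by (intro mult_left_mono) auto
      also have "\<dots> = M"
        using M0 by (simp add: powr_add [symmetric])
      finally show ?thesis
        using k0 by (simp add: field_simps)
    qed
    moreover have "4 * M powr (1/5) \<le> M powr (3/4)"
    proof -
      have "16 \<le> M"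
        using M k by linarith
      then have "sqrt 16 \<le> sqrt M"
        by (rule real_sqrt_le_mono)
      then have "4 \<le> M powr (1/2)"
        using M0 by (simp add: powr_half_sqrt)
      then have "4 * M powr (1/5) \<le> M powr (1/2) * M powr (1/4)"
        using M0 M k by (intro mult_mono powr_mono) auto
      then show ?thesis
        by (simp add: powr_add [symmetric])
    qed
    ultimately have "4 * M powr (1/5) \<le> real B"
      by linarith
    then have B: "exp (ln M / 5) \<le> real B / 4"
      using M0 by (simp add: powr_def)
    then have B0: "B \<noteq> 0"
      by (metis div_0 exp_gt_zero linorder_not_le of_nat_0)
    have "card ({..<k} \<times> {..<B}) \<le> card I"
      by (simp add: B_def)
    then obtain e where e: "e ` ({..<k} \<times> {..<B}) \<subseteq> I" "inj_on e ({..<k} \<times> {..<B})"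
      using I card_le_inj [of "{..<k} \<times> {..<B}" I] by auto
    have "\<exists>S\<subseteq>e ` ({..<k} \<times> {..<B}). card S \<le> card {..<k} \<and>
           real (card {..<k}) / 2 \<le> (\<Sum>i\<in>e ` ({..<k} \<times> {..<B}). sel_error A u S i)"
    proof (rule one_per_block_selection_risk [where \<tau> = "ln M / 5"])
      show "exp (ln M / 5) \<le> real (card {..<B}) / 4"
        using B by simp
    qed (use e A u B0 in \<open>auto simp: M_def image_subset_iff\<close>)
    then obtain S where S: "S \<subseteq> e ` ({..<k} \<times> {..<B})" "card S \<le> k"
        "real k / 2 \<le> (\<Sum>i\<in>e ` ({..<k} \<times> {..<B}). sel_error A u S i)"
      by auto
    have "real k powr (4/5) \<le> real k powr 1"
      using k by (intro powr_mono) auto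
    then have "real k powr (4/5) / 10 \<le> (\<Sum>i\<in>e ` ({..<k} \<times> {..<B}). sel_error A u S i)"
      using S(3) k0 by simp
    then show ?thesis
      using extend e S by blast
  qed
qed

lemma obs_law_eq_std_gauss: "obs_law X \<sigma> \<beta> = distr std_gauss borel (\<lambda>z. X *v \<beta> + \<sigma> *\<^sub>R z)"
proof -
  have "(\<lambda>\<xi>. \<chi> i. \<xi> i) \<in> std_normal_noise \<rightarrow>\<^sub>M borel"
    unfolding std_normal_noise_def by (rule measurable_vec_lambda_PiM)
  then show ?thesis
    unfolding obs_law_def std_gauss_def by (subst distr_distr) (auto simp: o_def)
qed

section \<open>From the linear model to the selection problem\<close>

text \<open>
  Dividing the observation by \<open>\<sigma>\<close> turns the linear model into the selection problem for the directions
  \<open>u\<close>. Restricting the Hamming loss to the coordinates in \<open>J\<close> only lowers it.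
\<close>

lemma hamming_risk_ge_sum_sel_error:
  fixes f :: "real ^ 'n::finite \<Rightarrow> real ^ 'k::finite" and X :: "real ^ 'q::finite ^ 'n"
  assumes f: "f \<in> selectors"
    and mean: "X *v \<beta> = \<sigma> *\<^sub>R (\<Sum>j\<in>S. u j)"
    and \<eta>: "\<And>i. i \<in> J \<Longrightarrow> \<eta> $ i = of_bool (i \<in> S)"
  shows "ennreal (\<Sum>i\<in>J. sel_error (\<lambda>i. {z. f (\<sigma> *\<^sub>R z) $ i = 1}) u S i)
    \<le> hamming_risk (obs_law X \<sigma> \<beta>) f \<eta>"
proof -
  interpret prob_space "std_gauss :: (real ^ 'n) measure" by (rule prob_space_std_gauss)
  have f_meas [measurable]: "f \<in> borel_measurable borel" and f01: "f y $ k = 0 \<or> f y $ k = 1" for y k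
    using f by (auto simp: selectors_def)
  have [measurable]: "(\<lambda>y. f y $ k) \<in> borel_measurable borel" for k
    by (rule measurable_compose [OF f_meas]) (intro borel_measurable_continuous_onI continuous_intros)
  define E where "E i = {z. (z + (\<Sum>j\<in>S. u j) \<in> {z. f (\<sigma> *\<^sub>R z) $ i = 1}) \<noteq> (i \<in> S)}" for i
  have E [measurable]: "E i \<in> sets borel" for i
    unfolding E_def by measurable
  have "ennreal (\<Sum>i\<in>J. measure std_gauss (E i)) = (\<Sum>i\<in>J. emeasure std_gauss (E i))"
    by (simp add: emeasure_eq_measure sum_ennreal)
  also have "\<dots> = (\<Sum>i\<in>J. \<integral>\<^sup>+ z. indicator (E i) z \<partial>std_gauss)"
    by simp
  also have "\<dots> = (\<integral>\<^sup>+ z. (\<Sum>i\<in>J. indicator (E i) z) \<partial>std_gauss)"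
    by (rule nn_integral_sum [symmetric]) simp
  also have "\<dots> \<le> (\<integral>\<^sup>+ z. ennreal (\<Sum>k\<in>UNIV. \<bar>f (X *v \<beta> + \<sigma> *\<^sub>R z) $ k - \<eta> $ k\<bar>) \<partial>std_gauss)"
  proof (rule nn_integral_mono)
    fix z :: "real ^ 'n"
    let ?y = "X *v \<beta> + \<sigma> *\<^sub>R z"
    have "(\<Sum>i\<in>J. indicat_real (E i) z) \<le> (\<Sum>i\<in>J. \<bar>f ?y $ i - \<eta> $ i\<bar>)"
    proof (rule sum_mono)
      fix i assume "i \<in> J"
      then show "indicat_real (E i) z \<le> \<bar>f ?y $ i - \<eta> $ i\<bar>"
        using f01 [of ?y i]
        by (auto simp: indicator_def E_def mean \<eta> scaleR_add_right [symmetric] add.commute)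
    qed
    also have "\<dots> \<le> (\<Sum>k\<in>UNIV. \<bar>f ?y $ k - \<eta> $ k\<bar>)"
      by (intro sum_mono2) auto
    finally have "ennreal (\<Sum>i\<in>J. indicat_real (E i) z) \<le> ennreal (\<Sum>k\<in>UNIV. \<bar>f ?y $ k - \<eta> $ k\<bar>)"
      by (rule ennreal_leI)
    moreover have "(\<Sum>i\<in>J. indicator (E i) z) = (\<Sum>i\<in>J. ennreal (indicat_real (E i) z))"
      by (simp only: ennreal_indicator)
    ultimately show "(\<Sum>i\<in>J. indicator (E i) z) \<le> ennreal (\<Sum>k\<in>UNIV. \<bar>f ?y $ k - \<eta> $ k\<bar>)"
      by simp
  qed
  also have "\<dots> = hamming_risk (obs_law X \<sigma> \<beta>) f \<eta>"
    unfolding hamming_risk_def obs_law_eq_std_gauss by (rule nn_integral_distr [symmetric]) simp_all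
  finally show ?thesis
    by (simp add: sel_error_def E_def)
qed

text \<open>
  The form shared by the two risks of the theorem: \<open>\<eta>\<close> is the pattern to be recovered, and the
  parameter set \<open>B\<close> realises every small set \<open>S\<close> as a pattern whose signal is the sum of the
  directions in \<open>S\<close>.
\<close>

lemma minimax_hamming_risk_ge:
  fixes X :: "real ^ 'q::finite ^ 'n::finite" and \<eta> :: "real ^ 'q \<Rightarrow> real ^ 'k::finite"
    and u :: "'k \<Rightarrow> real ^ 'n"
  assumes k: "25 \<le> k" "2 * k < card J"
    and u: "\<And>i. i \<in> J \<Longrightarrow> (norm (u i))\<^sup>2 \<le> ln (real (card J) - real k) / 5"
    and B: "\<And>S. S \<subseteq> J \<Longrightarrow> card S \<le> k \<Longrightarrow> \<exists>\<beta>\<in>B.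
      X *v \<beta> = \<sigma> *\<^sub>R (\<Sum>j\<in>S. u j) \<and> (\<forall>i\<in>J. \<eta> \<beta> $ i = of_bool (i \<in> S))"
  shows "ennreal (real k powr (4/5) / 10)
    \<le> (INF f\<in>selectors. SUP \<beta>\<in>B. hamming_risk (obs_law X \<sigma> \<beta>) f (\<eta> \<beta>))"
proof (rule INF_greatest)
  fix f :: "real ^ 'n \<Rightarrow> real ^ 'k" assume f: "f \<in> selectors"
  then have [measurable]: "f \<in> borel_measurable borel"
    by (simp add: selectors_def)
  have "{z. f (\<sigma> *\<^sub>R z) $ i = 1} \<in> sets borel" for i
    by measurable
  then have "\<exists>S\<subseteq>J. card S \<le> k \<and> real k powr (4/5) / 10
      \<le> (\<Sum>i\<in>J. sel_error (\<lambda>i. {z. f (\<sigma> *\<^sub>R z) $ i = 1}) u S i)"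
    by (intro sparse_selection_risk k u) simp_all
  then obtain S where S: "S \<subseteq> J" "card S \<le> k"
    and risk: "real k powr (4/5) / 10 \<le> (\<Sum>i\<in>J. sel_error (\<lambda>i. {z. f (\<sigma> *\<^sub>R z) $ i = 1}) u S i)"
    by blast
  obtain \<beta> where \<beta>: "\<beta> \<in> B" "X *v \<beta> = \<sigma> *\<^sub>R (\<Sum>j\<in>S. u j)" "\<And>i. i \<in> J \<Longrightarrow> \<eta> \<beta> $ i = of_bool (i \<in> S)"
    using B [OF S] by blast
  have "ennreal (real k powr (4/5) / 10)
      \<le> ennreal (\<Sum>i\<in>J. sel_error (\<lambda>i. {z. f (\<sigma> *\<^sub>R z) $ i = 1}) u S i)"
    using risk by (rule ennreal_leI)
  also have "\<dots> \<le> hamming_risk (obs_law X \<sigma> \<beta>) f (\<eta> \<beta>)"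
    using f \<beta> by (intro hamming_risk_ge_sum_sel_error)
  also have "\<dots> \<le> (SUP \<beta>\<in>B. hamming_risk (obs_law X \<sigma> \<beta>) f (\<eta> \<beta>))"
    using \<beta>(1) by (rule SUP_upper)
  finally show "ennreal (real k powr (4/5) / 10)
      \<le> (SUP \<beta>\<in>B. hamming_risk (obs_law X \<sigma> \<beta>) f (\<eta> \<beta>))" .
qed

section \<open>Signals of minimal strength\<close>

definition constant_signal :: "real \<Rightarrow> 'k set \<Rightarrow> real ^ 'k::finite"
  where "constant_signal a S = (\<chi> k. if k \<in> S then a else 0)"

lemma supp_constant_signal: "a \<noteq> 0 \<Longrightarrow> supp (constant_signal a S) = S"
  by (simp add: supp_def constant_signal_def)

lemma mult_constant_signal: "X *v constant_signal a S = a *\<^sub>R (\<Sum>k\<in>S. column k X)"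
proof -
  have "X *v constant_signal a S = (\<Sum>k\<in>UNIV. if k \<in> S then a *\<^sub>R column k X else 0)"
    unfolding matrix_mult_sum by (auto simp: constant_signal_def scalar_mult_eq_scaleR intro!: sum.cong)
  also have "\<dots> = a *\<^sub>R (\<Sum>k\<in>S. column k X)"
    by (simp add: sum.If_cases scaleR_sum_right)
  finally show ?thesis .
qed

lemma group_part_constant_signal_nonzero:
  "a \<noteq> 0 \<Longrightarrow> group_part (constant_signal a S) j \<noteq> 0 \<longleftrightarrow> j \<in> snd ` S"
proof -
  assume a: "a \<noteq> 0"
  have "group_part (constant_signal a S) j \<noteq> 0 \<longleftrightarrow> (\<exists>i. (i, j) \<in> S)"
    using a by (simp add: group_part_def constant_signal_def vec_eq_iff)
  also have "\<dots> \<longleftrightarrow> j \<in> snd ` S"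
    by (simp add: image_iff Bex_def)
  finally show ?thesis .
qed

lemma constant_signal_in_Theta_e:
  assumes "a > 0" "card (snd ` S) \<le> s" "card S \<le> s * s0"
  shows "constant_signal a S \<in> Theta_e s s0 a"
proof -
  have "{j. group_part (constant_signal a S) j \<noteq> 0} = snd ` S"
    using assms group_part_constant_signal_nonzero [of a S] by auto
  then show ?thesis
    using assms by (simp add: Theta_e_def Theta_def supp_constant_signal) (simp add: constant_signal_def)
qed

lemma eta_constant_signal: "a \<noteq> 0 \<Longrightarrow> eta (constant_signal a S) $ k = of_bool (k \<in> S)"
  by (simp add: eta_def constant_signal_def)

text \<open>
  The upper half of DSRIP, applied to the all-ones vector on \<open>s0\<close> coordinates of a single group, bounds
  the effect on the observation of switching on a whole group.
\<close>

lemma DSRIP_group_norm: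
  fixes X :: "real ^ ('d::finite \<times> 'm::finite) ^ 'n::finite"
  assumes X: "DSRIP X s s0 \<delta>" and s: "0 < s" and s0: "0 < s0" and T: "card T = s0"
  shows "(norm (\<Sum>i\<in>T. column (i, j) X))\<^sup>2 \<le> real CARD('n) * (1 + \<delta>) * real s0"
proof -
  define S where "S = T \<times> {j}"
  have ne: "T \<noteq> {}"
    using T s0 by auto
  have "snd ` S = {j}"
    using ne by (auto simp: S_def)
  then have "constant_signal 1 S \<in> Theta_e s s0 1"
    using s T by (intro constant_signal_in_Theta_e) (auto simp: S_def card_cartesian_product)
  then have "S \<in> ds_supports s s0"
    unfolding ds_supports_def Theta_e_def by (auto simp: supp_constant_signal intro: image_eqI [of _ _ "constant_signal 1 S"])
  then have "(norm (\<Sum>k\<in>S. 1 *\<^sub>R column k X))\<^sup>2 \<le> real CARD('n) * (1 + \<delta>) * (L2_set (\<lambda>_. 1) S)\<^sup>2"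
    using X ne unfolding DSRIP_def S_def by fastforce
  also have "(L2_set (\<lambda>_. 1) S)\<^sup>2 = real s0"
    using T by (simp add: L2_set_def S_def card_cartesian_product)
  also have "(\<Sum>k\<in>S. 1 *\<^sub>R column k X) = (\<Sum>i\<in>T. column (i, j) X)"
    using sum.cartesian_product [of "\<lambda>i j'. column (i, j') X" "{j}" T] by (simp add: S_def)
  finally show ?thesis .
qed

theorem theorem5:
  fixes X :: "real ^ ('d::finite \<times> 'm::finite) ^ 'n::finite"
    and s s0 :: nat
    and \<sigma> \<delta> a :: real
  assumes "\<sigma> > 0"
    and "\<And>k. norm (column k X) = sqrt (real CARD('n))"
    and "25 \<le> s" and "real s < real CARD('m) / 2"
    and "0 < s0" and "real s0 < real CARD('d) / 2"
    and "s * s0 \<ge> 54"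
    and "0 < \<delta>" and "\<delta> < 1"
    and "DSRIP X s s0 \<delta>"
    and "a > 0"
    and "a\<^sup>2 \<le> \<sigma>\<^sup>2 / (10 * real CARD('n)) *
          (ln (real CARD('m) - real s) / (real s0 * (1 + \<delta>))
            + ln (real s * real CARD('d) - real s * real s0))"
  shows "(INF f\<in>(selectors :: (real ^ 'n \<Rightarrow> real ^ ('d \<times> 'm)) set).
            SUP \<beta>\<in>Theta_e s s0 a. hamming_risk (obs_law X \<sigma> \<beta>) f (eta \<beta>))
          \<ge> ennreal ((real s * real s0) powr (4/5) / 10)
    \<or> (INF g\<in>(selectors :: (real ^ 'n \<Rightarrow> real ^ 'm) set).
            SUP \<beta>\<in>Theta_e s s0 a. hamming_risk (obs_law X \<sigma> \<beta>) g (eta_group \<beta>))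
          \<ge> ennreal (real s powr (7/10) / 20)"
proof -
  define n where "n = real CARD('n)"
  have n: "0 < n"
    by (simp add: n_def)
  \<comment> \<open>The group term and the within-group term; the larger one decides which risk is large.\<close>
  define L\<^sub>G where "L\<^sub>G = ln (real CARD('m) - real s) / (real s0 * (1 + \<delta>))"
  define L\<^sub>E where "L\<^sub>E = ln (real s * real CARD('d) - real s * real s0)"
  have "a\<^sup>2 \<le> \<sigma>\<^sup>2 / (10 * n) * (L\<^sub>G + L\<^sub>E)"
    using assms(12) by (simp add: n_def L\<^sub>G_def L\<^sub>E_def)
  then have a: "10 * (n * a\<^sup>2) \<le> \<sigma>\<^sup>2 * (L\<^sub>G + L\<^sub>E)"
    using n by (simp add: field_simps)
  have \<sigma>2: "0 < \<sigma>\<^sup>2"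
    using assms(1) by simp
  show ?thesis
  proof (cases "L\<^sub>G \<le> L\<^sub>E")
    case True
    then have "\<sigma>\<^sup>2 * (L\<^sub>G + L\<^sub>E) \<le> \<sigma>\<^sup>2 * (2 * L\<^sub>E)"
      using \<sigma>2 by (intro mult_left_mono) auto
    with a have "5 * (n * a\<^sup>2) \<le> \<sigma>\<^sup>2 * L\<^sub>E"
      by linarith
    then have aE: "(a / \<sigma>)\<^sup>2 * n \<le> L\<^sub>E / 5"
      using \<sigma>2 by (simp add: field_simps)
    \<comment> \<open>Restricted to \<open>s\<close> fixed groups, any support of size \<open>s * s0\<close> is admissible.\<close>
    obtain J0 :: "'m set" where J0: "card J0 = s"
      using obtain_subset_with_card_n [of s "UNIV :: 'm set"] assms(4) by auto
    define J where "J = (UNIV :: 'd set) \<times> J0"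
    have card_J: "card J = s * CARD('d)"
      by (simp add: J_def card_cartesian_product J0)
    have "2 * s0 < CARD('d)"
      using assms(6) by linarith
    then have "s * (2 * s0) < s * CARD('d)"
      using assms(3) by (intro mult_strict_left_mono) auto
    then have "ennreal (real (s * s0) powr (4/5) / 10)
      \<le> (INF f\<in>(selectors :: (real ^ 'n \<Rightarrow> real ^ ('d \<times> 'm)) set).
            SUP \<beta>\<in>Theta_e s s0 a. hamming_risk (obs_law X \<sigma> \<beta>) f (eta \<beta>))"
    proof (intro minimax_hamming_risk_ge [where J = J and u = "\<lambda>k. (a / \<sigma>) *\<^sub>R column k X"])
      fix k
      show "(norm ((a / \<sigma>) *\<^sub>R column k X))\<^sup>2 \<le> ln (real (card J) - real (s * s0)) / 5"
        using aE by (simp add: power_mult_distrib power_divide assms(2) card_J L\<^sub>E_def n_def)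
    next
      fix S :: "('d \<times> 'm) set" assume S: "S \<subseteq> J" "card S \<le> s * s0"
      have "card (snd ` S) \<le> card J0"
        using S by (intro card_mono) (auto simp: J_def)
      then have "constant_signal a S \<in> Theta_e s s0 a"
        using S assms(11) J0 by (intro constant_signal_in_Theta_e) auto
      moreover have "X *v constant_signal a S = \<sigma> *\<^sub>R (\<Sum>k\<in>S. (a / \<sigma>) *\<^sub>R column k X)"
        using assms(1) by (simp add: mult_constant_signal scaleR_sum_right)
      ultimately show "\<exists>\<beta>\<in>Theta_e s s0 a. X *v \<beta> = \<sigma> *\<^sub>R (\<Sum>k\<in>S. (a / \<sigma>) *\<^sub>R column k X)
          \<and> (\<forall>k\<in>J. eta \<beta> $ k = of_bool (k \<in> S))"
        using assms(11) by (auto simp: eta_constant_signal)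
    qed (use assms(7) card_J in auto)
    then show ?thesis
      by simp
  next
    case False
    then have "\<sigma>\<^sup>2 * (L\<^sub>G + L\<^sub>E) \<le> \<sigma>\<^sup>2 * (2 * L\<^sub>G)"
      using \<sigma>2 by (intro mult_left_mono) auto
    with a have "5 * (n * a\<^sup>2) \<le> \<sigma>\<^sup>2 * L\<^sub>G"
      by linarith
    then have a5: "(a / \<sigma>)\<^sup>2 * n \<le> L\<^sub>G / 5"
      using \<sigma>2 by (simp add: field_simps)
    define q where "q = real s0 * (1 + \<delta>)"
    have q: "0 < q"
      using assms(5,8) by (simp add: q_def)
    have "(a / \<sigma>)\<^sup>2 * n * q \<le> L\<^sub>G / 5 * q"
      using a5 q by (intro mult_right_mono) auto
    also have "\<dots> = ln (real CARD('m) - real s) / 5"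
      using q by (simp add: L\<^sub>G_def q_def [symmetric])
    finally have aG: "(a / \<sigma>)\<^sup>2 * (n * (1 + \<delta>) * real s0) \<le> ln (real CARD('m) - real s) / 5"
      by (simp add: q_def mult.assoc mult.left_commute mult.commute)
    \<comment> \<open>A group is switched on along the fixed pattern \<open>T\<close>, so only the set of active groups is unknown.\<close>
    obtain T :: "'d set" where T: "card T = s0"
      using obtain_subset_with_card_n [of s0 "UNIV :: 'd set"] assms(6) by auto
    have T_ne: "T \<noteq> {}"
      using T assms(5) by auto
    let ?u = "\<lambda>j. (a / \<sigma>) *\<^sub>R (\<Sum>i\<in>T. column (i, j) X)"
    have group_risk: "ennreal (real s powr (4/5) / 10)
      \<le> (INF g\<in>(selectors :: (real ^ 'n \<Rightarrow> real ^ 'm) set).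
            SUP \<beta>\<in>Theta_e s s0 a. hamming_risk (obs_law X \<sigma> \<beta>) g (eta_group \<beta>))"
    proof (intro minimax_hamming_risk_ge [where J = UNIV and u = ?u])
      fix j
      have "(norm (?u j))\<^sup>2 = (a / \<sigma>)\<^sup>2 * (norm (\<Sum>i\<in>T. column (i, j) X))\<^sup>2"
        by (simp add: power_mult_distrib power_divide)
      also have "\<dots> \<le> (a / \<sigma>)\<^sup>2 * (n * (1 + \<delta>) * real s0)"
        using DSRIP_group_norm [OF assms(10) _ assms(5) T, of j] assms(3)
        by (intro mult_left_mono) (auto simp: n_def)
      finally show "(norm (?u j))\<^sup>2 \<le> ln (real CARD('m) - real s) / 5"
        using aG by linarith
    next
      fix S :: "'m set" assume S: "S \<subseteq> UNIV" "card S \<le> s"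
      let ?\<beta> = "constant_signal a (T \<times> S)"
      have groups: "snd ` (T \<times> S) = S"
        using T_ne by auto
      have "card (T \<times> S) \<le> s * s0"
        using S T by (simp add: card_cartesian_product)
      then have "?\<beta> \<in> Theta_e s s0 a"
        using S assms(11) groups by (intro constant_signal_in_Theta_e) auto
      moreover have "X *v ?\<beta> = \<sigma> *\<^sub>R (\<Sum>j\<in>S. ?u j)"
      proof -
        have "(\<Sum>k\<in>T \<times> S. column k X) = (\<Sum>j\<in>S. \<Sum>i\<in>T. column (i, j) X)"
          by (subst sum.swap) (simp add: sum.cartesian_product)
        then show ?thesis
          using assms(1) by (simp add: mult_constant_signal scaleR_sum_right)
      qed
      moreover have "eta_group ?\<beta> $ j = of_bool (j \<in> S)" for j
        using group_part_constant_signal_nonzero [of a "T \<times> S" j] groups assms(11) by (simp add: eta_group_def)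
      ultimately show "\<exists>\<beta>\<in>Theta_e s s0 a. X *v \<beta> = \<sigma> *\<^sub>R (\<Sum>j\<in>S. ?u j)
          \<and> (\<forall>j\<in>UNIV. eta_group \<beta> $ j = of_bool (j \<in> S))"
        by blast
    qed (use assms(3,4) in auto)
    have "real s powr (7/10) / 20 \<le> real s powr (4/5) / 10"
    proof -
      have "real s powr (7/10) \<le> real s powr (4/5)"
        using assms(3) by (intro powr_mono) auto
      then show ?thesis
        using powr_ge_zero [of "real s" "4/5"] by linarith
    qed
    then have "ennreal (real s powr (7/10) / 20) \<le> ennreal (real s powr (4/5) / 10)"
      by (rule ennreal_leI)
    also note group_risk
    finally show ?thesis ..
  qed
qed

end
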